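(* Let $\{(\xi_m,\tau_m)\}_{m=1}^M\subset\mathbb{R}^d\times(0,\infty)$ be any $M$-point positive quadrature rule that is exact on $P_\Lambda^3$, i.e. $$\int_{\mathbb{R}^d}p(\xi)\rho(\xi)\,d\xi=\sum_{m=1}^M p(\xi_m)\tau_m\qquad\text{for all } p\in P_\Lambda^3 .$$ Let $h_\Lambda(x,t,\xi)=\sum_{k=1}^K\hat h_k(x,t)\phi_k(\xi)$. If $$h_\Lambda(x,t,\xi_m)>0\qquad\text{for all } m=1,\dots,M,$$ then the stochastic Galerkin shallow water system $\hat U_t+(F(\hat U))_x=S(\hat U,\hat B)$ is hyperbolic (at the state $\hat U=(\hat h(x,t),\hat q(x,t))$, for any $\hat q(x,t)\in\mathbb{R}^K$).
   Context: Let $\rho:\mathbb{R}^d\to\mathbb{R}$ be a (Lebesgue) probability density with finite polynomial moments of all orders and $\langle f,g\rangle_\rho=\int_{\mathbb{R}^d} f g\,\rho\,ds$. Let $\Lambda\subset\mathbb{N}_0^d$ be a finite set of multi-indices with $0\in\Lambda$ and $|\Lambda|=K$, let $P_\Lambda=\mathrm{span}\{\zeta^\nu : \nu\in\Lambda\}$, and let $\phi_1\equiv 1,\phi_2,\dots,\phi_K$ be an $L^2_\rho$-orthonormal basis of $P_\Lambda$. Define $P_\Lambda^r=\mathrm{span}\{\prod_{j=1}^r p_j : p_j\in P_\Lambda\}$. For $\hat y\in\mathbb{R}^K$ define $\mathcal{P}(\hat y)=\sum_{k=1}^K\hat y_k\mathcal{M}_k\in\mathbb{R}^{K\times K}$,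 where $(\mathcal{M}_k)_{\ell m}=\langle\phi_k,\phi_\ell\phi_m\rangle_\rho$. Let $g>0$ be the gravitational constant. The stochastic Galerkin shallow water system for the unknown $\hat U=(\hat h,\hat q)$, with $\hat h(x,t),\hat q(x,t)\in\mathbb{R}^K$, and with a given bottom-topography coefficient vector $\hat B(x)\in\mathbb{R}^K$, is $\hat U_t+(F(\hat U))_x=S(\hat U,\hat B)$, where $$F(\hat U)=\begin{pmatrix}\hat q\\ \tfrac12 g\mathcal{P}(\hat h)\hat h+\mathcal{P}(\hat q)\mathcal{P}^{-1}(\hat h)\hat q\end{pmatrix},\qquad S(\hat U,\hat B)=\begin{pmatrix}0\\-g\mathcal{P}(\hat h)\hat B_x\end{pmatrix}.$$ With $\hat u=\mathcal{P}^{-1}(\hat h)\hat q$, its flux Jacobian is $$J(\hat U)=\frac{\partial F}{\partial\hat U}=\begin{pmatrix}O&I\\ g\mathcal{P}(\hat h)-\mathcal{P}(\hat q)\mathcal{P}^{-1}(\hat h)\mathcal{P}(\hat u)&\mathcal{P}(\hat u)+\mathcal{P}(\hat q)\mathcal{P}^{-1}(\hat h)\end{pmatrix}.$$ The system is called hyperbolic (at the state $\hat U$) if $\mathcal{P}(\hat h)$ is invertible (so that $J(\hat U)$ is defined) and $J(\hat U)$ is diagonalizable over $\mathbb{R}$ with real eigenvalues. *)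

theory Defs
  imports "HOL-Analysis.Analysis" "HOL-Library.Function_Algebras"
begin

section \<open>Polynomial spaces\<close>

text \<open>
  Real-valued functions form a vector space under pointwise operations; there is no
  \<^class>\<open>real_vector\<close> instance for them, so the scalar multiplication is made explicit.
\<close>

interpretation fun_space: vector_space "\<lambda>(c::real) (f :: 'a \<Rightarrow> real) x. c * f x"
  by unfold_locales (auto simp: fun_eq_iff algebra_simps)

definition monomial :: "nat ^ 'd \<Rightarrow> real ^ 'd \<Rightarrow> real" where
  "monomial \<nu> \<zeta> = (\<Prod>i\<in>UNIV. (\<zeta> $ i) ^ (\<nu> $ i))"

definition poly_space :: "(nat ^ 'd) set \<Rightarrow> (real ^ 'd \<Rightarrow> real) set" where
  "poly_space \<Lambda> = fun_space.span (monomial ` \<Lambda>)"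

definition poly_space_power :: "(nat ^ 'd) set \<Rightarrow> nat \<Rightarrow> (real ^ 'd \<Rightarrow> real) set" where
  "poly_space_power \<Lambda> r =
     fun_space.span {\<lambda>\<zeta>. \<Prod>j = 1..r. p j \<zeta> | p. \<forall>j\<in>{1..r}. p j \<in> poly_space \<Lambda>}"


section \<open>Weighted inner product and orthonormal bases\<close>

definition probability_density :: "(real ^ 'd \<Rightarrow> real) \<Rightarrow> bool" where
  "probability_density \<rho> \<longleftrightarrow> (\<forall>s. 0 \<le> \<rho> s) \<and> has_bochner_integral lebesgue \<rho> 1"

definition finite_moments :: "(real ^ 'd \<Rightarrow> real) \<Rightarrow> bool" where
  "finite_moments \<rho> \<longleftrightarrow> (\<forall>\<nu>. integrable lebesgue (\<lambda>s. monomial \<nu> s * \<rho> s))"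

definition inner_rho :: "(real ^ 'd \<Rightarrow> real) \<Rightarrow> (real ^ 'd \<Rightarrow> real) \<Rightarrow> (real ^ 'd \<Rightarrow> real) \<Rightarrow> real" where
  "inner_rho \<rho> f g = (LINT s|lebesgue. f s * g s * \<rho> s)"

text \<open>Linear independence and injectivity of \<open>\<phi>\<close> follow from orthonormality.\<close>

definition orthonormal_basis ::
  "(real ^ 'd \<Rightarrow> real) \<Rightarrow> (real ^ 'd \<Rightarrow> real) set \<Rightarrow> ('k \<Rightarrow> real ^ 'd \<Rightarrow> real) \<Rightarrow> bool" where
  "orthonormal_basis \<rho> V \<phi> \<longleftrightarrow>
     fun_space.span (range \<phi>) = V \<and>
     (\<forall>k l. inner_rho \<rho> (\<phi> k) (\<phi> l) = (if k = l then 1 else 0))"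

definition positive_quadrature ::
  "(real ^ 'd \<Rightarrow> real) \<Rightarrow> (real ^ 'd \<Rightarrow> real) set \<Rightarrow> nat \<Rightarrow> (nat \<Rightarrow> real ^ 'd) \<Rightarrow> (nat \<Rightarrow> real) \<Rightarrow> bool" where
  "positive_quadrature \<rho> V M \<xi> \<tau> \<longleftrightarrow>
     (\<forall>m\<in>{1..M}. 0 < \<tau> m) \<and>
     (\<forall>p\<in>V. (LINT s|lebesgue. p s * \<rho> s) = (\<Sum>m = 1..M. p (\<xi> m) * \<tau> m))"


section \<open>The stochastic Galerkin shallow water system\<close>

definition triple_matrix ::
  "(real ^ 'd \<Rightarrow> real) \<Rightarrow> ('k \<Rightarrow> real ^ 'd \<Rightarrow> real) \<Rightarrow> 'k \<Rightarrow> real ^ 'k ^ 'k" where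
  "triple_matrix \<rho> \<phi> k = (\<chi> l m. inner_rho \<rho> (\<phi> k) (\<lambda>s. \<phi> l s * \<phi> m s))"

definition galerkin_matrix ::
  "(real ^ 'd \<Rightarrow> real) \<Rightarrow> ('k::finite \<Rightarrow> real ^ 'd \<Rightarrow> real) \<Rightarrow> real ^ 'k \<Rightarrow> real ^ 'k ^ 'k" where
  "galerkin_matrix \<rho> \<phi> y = (\<Sum>k\<in>UNIV. (y $ k) *\<^sub>R triple_matrix \<rho> \<phi> k)"

text \<open>
  A state in \<open>\<real>\<^sup>2\<^sup>K\<close> is a vector indexed by the sum type: the left summand carries the
  water height, the right summand the discharge.
\<close>

definition stack :: "real ^ 'k \<Rightarrow> real ^ 'k \<Rightarrow> real ^ ('k + 'k)" where
  "stack a b = (\<chi> i. case i of Inl k \<Rightarrow> a $ k | Inr k \<Rightarrow> b $ k)"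

definition height :: "real ^ ('k + 'k) \<Rightarrow> real ^ 'k" where
  "height U = (\<chi> k. U $ Inl k)"

definition discharge :: "real ^ ('k + 'k) \<Rightarrow> real ^ 'k" where
  "discharge U = (\<chi> k. U $ Inr k)"

definition sgswe_flux ::
  "real \<Rightarrow> (real ^ 'd \<Rightarrow> real) \<Rightarrow> ('k::finite \<Rightarrow> real ^ 'd \<Rightarrow> real) \<Rightarrow>
     real ^ ('k + 'k) \<Rightarrow> real ^ ('k + 'k)" where
  "sgswe_flux g \<rho> \<phi> U =
     (let P = galerkin_matrix \<rho> \<phi>; h = height U; q = discharge U
      in stack q ((g / 2) *\<^sub>R (P h *v h) + P q *v (matrix_inv (P h) *v q)))"

definition real_diagonalizable :: "real ^ 'n ^ 'n \<Rightarrow> bool" where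
  "real_diagonalizable A \<longleftrightarrow>
     (\<exists>V D :: real ^ 'n ^ 'n. invertible V \<and> (\<forall>i j. i \<noteq> j \<longrightarrow> D $ i $ j = 0) \<and>
        A = V ** D ** matrix_inv V)"

text \<open>
  Hyperbolicity is a property of the flux at a state; the source term, which contains no
  derivative of the unknown, does not enter.  The differentiability implicit in the use of
  \<^const>\<open>jacobian\<close> and the block form of the Jacobian matrix are established in
  \<open>sgswe_flux_has_derivative\<close> and \<open>jacobian_sgswe_flux\<close> below.
\<close>

definition sgswe_hyperbolic_at ::
  "real \<Rightarrow> (real ^ 'd \<Rightarrow> real) \<Rightarrow> ('k::finite \<Rightarrow> real ^ 'd \<Rightarrow> real) \<Rightarrow> real ^ ('k + 'k) \<Rightarrow> bool" where
  "sgswe_hyperbolic_at g \<rho> \<phi> U \<longleftrightarrow>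
     invertible (galerkin_matrix \<rho> \<phi> (height U)) \<and>
     real_diagonalizable (jacobian (sgswe_flux g \<rho> \<phi>) (at U))"


section \<open>The flux Jacobian in block form\<close>

definition block_matrix ::
  "real ^ 'k ^ 'k \<Rightarrow> real ^ 'k ^ 'k \<Rightarrow> real ^ 'k ^ 'k \<Rightarrow> real ^ 'k ^ 'k \<Rightarrow> real ^ ('k + 'k) ^ ('k + 'k)" where
  "block_matrix A B C D =
     (\<chi> i j. case i of
        Inl k \<Rightarrow> (case j of Inl l \<Rightarrow> A $ k $ l | Inr l \<Rightarrow> B $ k $ l)
      | Inr k \<Rightarrow> (case j of Inl l \<Rightarrow> C $ k $ l | Inr l \<Rightarrow> D $ k $ l))"

definition sgswe_jacobian ::
  "real \<Rightarrow> (real ^ 'd \<Rightarrow> real) \<Rightarrow> ('k::finite \<Rightarrow> real ^ 'd \<Rightarrow> real) \<Rightarrow>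
     real ^ ('k + 'k) \<Rightarrow> real ^ ('k + 'k) ^ ('k + 'k)" where
  "sgswe_jacobian g \<rho> \<phi> U =
     (let P = galerkin_matrix \<rho> \<phi>; h = height U; q = discharge U; u = matrix_inv (P h) *v q
      in block_matrix
           0                                            (mat 1)
           (g *\<^sub>R P h - P q ** matrix_inv (P h) ** P u)  (P u + P q ** matrix_inv (P h)))"

lemma height_stack [simp]: "height (stack a b) = a"
  by (simp add: height_def stack_def vec_eq_iff)

lemma discharge_stack [simp]: "discharge (stack a b) = b"
  by (simp add: discharge_def stack_def vec_eq_iff)

lemma stack_height_discharge [simp]: "stack (height U) (discharge U) = U"
  by (simp add: height_def discharge_def stack_def vec_eq_iff split: sum.split)

lemma linear_height: "linear height"
  by (rule linearI) (simp_all add: height_def vec_eq_iff)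

lemma linear_discharge: "linear discharge"
  by (rule linearI) (simp_all add: discharge_def vec_eq_iff)

lemma linear_stack: "linear (\<lambda>x. stack (fst x) (snd x))"
  by (rule linearI) (simp_all add: stack_def vec_eq_iff split: sum.split)

lemma block_matrix_mult:
  "block_matrix A B C D *v U =
     stack (A *v height U + B *v discharge U) (C *v height U + D *v discharge (U :: real ^ ('k::finite + 'k)))"
proof -
  have split: "(\<Sum>j\<in>UNIV. f j) = (\<Sum>l\<in>UNIV. f (Inl l)) + (\<Sum>l\<in>UNIV. f (Inr l))"
    for f :: "'k + 'k \<Rightarrow> real"
    by (simp add: UNIV_Plus_UNIV[symmetric] Plus_def sum.union_disjoint sum.reindex
        del: UNIV_Plus_UNIV)
       (subst sum.union_disjoint; auto simp: sum.reindex)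
  show ?thesis
    by (simp add: vec_eq_iff block_matrix_def stack_def height_def discharge_def
        matrix_vector_mult_def split split: sum.split)
qed

lemma triple_matrix_sym: "triple_matrix \<rho> \<phi> k $ l $ m = triple_matrix \<rho> \<phi> m $ l $ k"
  by (simp add: triple_matrix_def inner_rho_def mult_ac)

lemma galerkin_matrix_nth:
  "galerkin_matrix \<rho> \<phi> y $ l $ m = (\<Sum>k\<in>UNIV. y $ k * triple_matrix \<rho> \<phi> k $ l $ m)"
  by (simp add: galerkin_matrix_def)

lemma galerkin_matrix_commute: "galerkin_matrix \<rho> \<phi> a *v b = galerkin_matrix \<rho> \<phi> b *v a"
proof -
  have "(galerkin_matrix \<rho> \<phi> a *v b) $ l = (galerkin_matrix \<rho> \<phi> b *v a) $ l" for l
  proof -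
    have "(galerkin_matrix \<rho> \<phi> a *v b) $ l
        = (\<Sum>m\<in>UNIV. \<Sum>k\<in>UNIV. a $ k * triple_matrix \<rho> \<phi> k $ l $ m * b $ m)"
      by (simp add: matrix_vector_mult_def galerkin_matrix_nth sum_distrib_right)
    also have "\<dots> = (\<Sum>k\<in>UNIV. \<Sum>m\<in>UNIV. a $ k * triple_matrix \<rho> \<phi> k $ l $ m * b $ m)"
      by (rule sum.swap)
    also have "\<dots> = (\<Sum>k\<in>UNIV. \<Sum>m\<in>UNIV. b $ m * triple_matrix \<rho> \<phi> m $ l $ k * a $ k)"
      by (intro sum.cong refl) (subst triple_matrix_sym, simp)
    also have "\<dots> = (galerkin_matrix \<rho> \<phi> b *v a) $ l"
      by (simp add: matrix_vector_mult_def galerkin_matrix_nth sum_distrib_right)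
    finally show ?thesis .
  qed
  then show ?thesis by (simp add: vec_eq_iff)
qed

lemma linear_galerkin_matrix: "linear (galerkin_matrix \<rho> \<phi>)"
  by (rule linearI)
     (simp_all add: galerkin_matrix_def scaleR_left_distrib sum.distrib scaleR_sum_right)

lemma bounded_bilinear_galerkin: "bounded_bilinear (\<lambda>a b. galerkin_matrix \<rho> \<phi> a *v b)"
proof -
  have "linear (\<lambda>b. galerkin_matrix \<rho> \<phi> a *v b)" for a
    by (rule matrix_vector_mul_linear)
  moreover have "linear (\<lambda>a. galerkin_matrix \<rho> \<phi> a *v b)" for b
    by (subst galerkin_matrix_commute) (rule matrix_vector_mul_linear)
  ultimately show ?thesis
    by (simp add: bilinear_conv_bounded_bilinear[symmetric] bilinear_def)
qed

lemma matrix_inv_cancel: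
  fixes A :: "real ^ 'n ^ 'n"
  assumes "invertible A"
  shows "matrix_inv A *v (A *v x) = x" "A *v (matrix_inv A *v x) = x"
proof -
  have "\<exists>B. A ** B = mat 1 \<and> B ** A = mat 1"
    using assms by (simp add: invertible_def)
  then have "A ** matrix_inv A = mat 1 \<and> matrix_inv A ** A = mat 1"
    unfolding matrix_inv_def by (rule someI_ex)
  then show "matrix_inv A *v (A *v x) = x" "A *v (matrix_inv A *v x) = x"
    by (simp_all add: matrix_vector_mul_assoc)
qed

lemma velocity_has_derivative:
  fixes \<rho> :: "real ^ 'd \<Rightarrow> real" and \<phi> :: "'k::finite \<Rightarrow> real ^ 'd \<Rightarrow> real"
  defines "P \<equiv> galerkin_matrix \<rho> \<phi>"
  assumes inv: "invertible (P h)"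
  shows "((\<lambda>x. matrix_inv (P (fst x)) *v snd x) has_derivative
          (\<lambda>d. matrix_inv (P h) *v (snd d - P (fst d) *v (matrix_inv (P h) *v q)))) (at (h, q))"
proof -
  interpret B: bounded_bilinear "\<lambda>a b. P a *v b"
    unfolding P_def by (rule bounded_bilinear_galerkin)
  define u where "u = matrix_inv (P h) *v q"
  define f where "f x = (fst x, P (fst x) *v snd x)" for x :: "(real^'k) \<times> (real^'k)"
  define G where "G x = (fst x, matrix_inv (P (fst x)) *v snd x)" for x :: "(real^'k) \<times> (real^'k)"
  define f' where "f' d = (fst d, P h *v snd d + P (fst d) *v u)" for d :: "(real^'k) \<times> (real^'k)"
  define G' where "G' d = (fst d, matrix_inv (P h) *v (snd d - P (fst d) *v u))"
    for d :: "(real^'k) \<times> (real^'k)"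
  define S where "S = {x :: (real^'k) \<times> (real^'k). det (P (fst x)) \<noteq> 0}"
  have q: "P h *v u = q"
    using matrix_inv_cancel[OF inv] by (simp add: u_def)
  have contP: "continuous_on UNIV P"
    unfolding P_def by (intro linear_continuous_on linear_conv_bounded_linear[THEN iffD1]
        linear_galerkin_matrix)
  have "open S"
  proof -
    have "continuous_on UNIV (\<lambda>x :: (real^'k) \<times> (real^'k). det (P (fst x)))"
      unfolding det_def
      by (intro continuous_intros continuous_on_compose2[OF contP]) auto
    moreover have "S = (\<lambda>x. det (P (fst x))) -` (- {0})"
      by (auto simp: S_def)
    ultimately show ?thesis by (metis open_vimage open_Compl closed_singleton)
  qed
  have xS: "(h, u) \<in> S"
    using inv by (simp add: S_def invertible_det_nz)
  have df: "(f has_derivative (\<lambda>d. (fst d, P (fst x) *v snd d + P (fst d) *v snd x))) (at x)" for x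
    unfolding f_def by (auto intro!: derivative_eq_intros B.FDERIV)
  have cf: "continuous_on S f"
    using df by (meson has_derivative_continuous continuous_at_imp_continuous_on)
  have gf: "G (f x) = x" if "x \<in> S" for x
    using that by (simp add: S_def G_def f_def invertible_det_nz[symmetric] matrix_inv_cancel)
  have "f' \<circ> G' = id"
    by (simp add: fun_eq_iff f'_def G'_def matrix_inv_cancel[OF inv])
  moreover have "(f has_derivative f') (at (h, u))"
    using df[of "(h, u)"] by (simp add: f'_def[abs_def])
  ultimately have "(G has_derivative G') (at (f (h, u)))"
    using has_derivative_inverse_strong[OF \<open>open S\<close> xS cf gf] by blast
  then have "((\<lambda>x. snd (G x)) has_derivative (\<lambda>d. snd (G' d))) (at (h, q))"
    using q by (auto simp: f_def intro: has_derivative_snd)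
  then show ?thesis by (simp add: G_def G'_def u_def)
qed

theorem sgswe_flux_has_derivative:
  fixes \<rho> :: "real ^ 'd \<Rightarrow> real" and \<phi> :: "'k::finite \<Rightarrow> real ^ 'd \<Rightarrow> real"
  assumes inv: "invertible (galerkin_matrix \<rho> \<phi> (height U))"
  shows "(sgswe_flux g \<rho> \<phi> has_derivative (\<lambda>d. sgswe_jacobian g \<rho> \<phi> U *v d)) (at U)"
proof -
  define P where "P = galerkin_matrix \<rho> \<phi>"
  interpret B: bounded_bilinear "\<lambda>a b. P a *v b"
    unfolding P_def by (rule bounded_bilinear_galerkin)
  define h where "h = height U"
  define q where "q = discharge U"
  define u where "u = matrix_inv (P h) *v q"
  define v where "v x = matrix_inv (P (height x)) *v discharge x" for x :: "real ^ ('k + 'k)"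
  define v' where "v' d = matrix_inv (P h) *v (discharge d - P (height d) *v u)"
    for d :: "real ^ ('k + 'k)"
  have dh: "(height has_derivative height) (at U)" and dq: "(discharge has_derivative discharge) (at U)"
    by (simp_all add: linear_imp_has_derivative linear_height linear_discharge)
  have "((\<lambda>x. (height x, discharge x)) has_derivative (\<lambda>d. (height d, discharge d))) (at U)"
    by (intro has_derivative_Pair dh dq)
  from has_derivative_compose[OF this velocity_has_derivative[of \<rho> \<phi> "height U" "discharge U", OF inv]]
  have dv: "(v has_derivative v') (at U)"
    by (simp add: v_def[abs_def] v'_def[abs_def] P_def u_def h_def q_def)
  have d2: "((\<lambda>x. (g / 2) *\<^sub>R (P (height x) *v height x) + P (discharge x) *v v x) has_derivative
      (\<lambda>d. (g / 2) *\<^sub>R (P h *v height d + P (height d) *v h) + (P q *v v' d + P (discharge d) *v u))) (at U)"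
  proof -
    have "v U = u" by (simp add: v_def u_def h_def q_def)
    then show ?thesis
      using has_derivative_add[OF has_derivative_scaleR_right[OF B.FDERIV[OF dh dh], of "g / 2"]
          B.FDERIV[OF dq dv]]
      by (simp add: h_def q_def)
  qed
  have "((\<lambda>x. (discharge x, (g / 2) *\<^sub>R (P (height x) *v height x) + P (discharge x) *v v x)) has_derivative
      (\<lambda>d. (discharge d, (g / 2) *\<^sub>R (P h *v height d + P (height d) *v h)
              + (P q *v v' d + P (discharge d) *v u)))) (at U)"
    by (intro has_derivative_Pair dq d2)
  from has_derivative_compose[OF this linear_imp_has_derivative[OF linear_stack]]
  have "(sgswe_flux g \<rho> \<phi> has_derivative
      (\<lambda>d. stack (discharge d) ((g / 2) *\<^sub>R (P h *v height d + P (height d) *v h)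
              + (P q *v v' d + P (discharge d) *v u)))) (at U)"
    by (simp add: sgswe_flux_def[abs_def] Let_def v_def P_def)
  moreover have "stack (discharge d) ((g / 2) *\<^sub>R (P h *v height d + P (height d) *v h)
              + (P q *v v' d + P (discharge d) *v u)) = sgswe_jacobian g \<rho> \<phi> U *v d" for d
  proof -
    have sym: "P (height d) *v h = P h *v height d" "P (discharge d) *v u = P u *v discharge d"
      "P (height d) *v u = P u *v height d"
      unfolding P_def by (rule galerkin_matrix_commute)+
    have half: "(g / 2) *\<^sub>R (x + x) = g *\<^sub>R x" for x :: "real ^ 'k"
      by (simp add: vec_eq_iff)
    have J: "sgswe_jacobian g \<rho> \<phi> U = block_matrix 0 (mat 1)
        (g *\<^sub>R P h - P q ** matrix_inv (P h) ** P u) (P u + P q ** matrix_inv (P h))"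
      by (simp add: sgswe_jacobian_def Let_def P_def h_def q_def u_def)
    show ?thesis
      unfolding J v'_def sym half
      by (simp add: block_matrix_mult matrix_vector_mult_diff_rdistrib matrix_vector_mult_add_rdistrib
          matrix_vector_mult_diff_distrib matrix_vector_mul_assoc scaleR_matrix_vector_assoc
          matrix_mul_assoc algebra_simps)
  qed
  ultimately show ?thesis by simp
qed

corollary jacobian_sgswe_flux:
  fixes \<rho> :: "real ^ 'd \<Rightarrow> real" and \<phi> :: "'k::finite \<Rightarrow> real ^ 'd \<Rightarrow> real"
  assumes "invertible (galerkin_matrix \<rho> \<phi> (height U))"
  shows "jacobian (sgswe_flux g \<rho> \<phi>) (at U) = sgswe_jacobian g \<rho> \<phi> U"
  using frechet_derivative_at[OF sgswe_flux_has_derivative[OF assms], of g]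
  by (metis jacobian_def matrix_of_matrix_vector_mul)

end

theory Submission
  imports Defs
begin

text \<open>
  Exactness on triple products turns the quadratic form of \<open>P(h)\<close> into
  \<open>a \<mapsto> \<Sum>\<^sub>m h\<^sub>\<Lambda>(\<xi>\<^sub>m) a\<^sub>\<Lambda>(\<xi>\<^sub>m)\<^sup>2 \<tau>\<^sub>m\<close>; since \<open>\<phi>\<^sub>1 = 1\<close>, orthonormality
  gives \<open>|a|\<^sup>2 = \<Sum>\<^sub>m a\<^sub>\<Lambda>(\<xi>\<^sub>m)\<^sup>2 \<tau>\<^sub>m\<close>, so \<open>P(h)\<close> is positive definite.  The
  Jacobian is then self-adjoint with respect to an explicit inner product built from
  \<open>P(h)\<^sup>-\<^sup>1\<close>, hence it has a basis of real eigenvectors.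
\<close>

section \<open>Spectral theorem for an arbitrary inner product\<close>

text \<open>The eigenvector is a maximiser of the Rayleigh quotient of \<open>T\<close> over
  \<open>V\<close>. The quotient is invariant under scaling, so it may be maximised over the
  Euclidean unit sphere, which is compact, although \<open>B\<close> induces a different
  norm.\<close>

lemma selfadjoint_exists_eigenvector:
  fixes T :: "'a::euclidean_space \<Rightarrow> 'a" and B :: "'a \<Rightarrow> 'a \<Rightarrow> real"
  assumes T: "linear T" and B: "bilinear B"
    and pos: "\<And>x. x \<noteq> 0 \<Longrightarrow> 0 < B x x"
    and adj: "\<And>x y. B (T x) y = B x (T y)"
    and V: "subspace V" and inv: "T ` V \<subseteq> V" and nontriv: "V \<noteq> {0}"
  obtains x \<mu> where "x \<in> V" "x \<noteq> 0" "T x = \<mu> *\<^sub>R x"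
proof -
  interpret B: bounded_bilinear B
    using B by (simp add: bilinear_conv_bounded_bilinear)
  define S where "S = V \<inter> sphere 0 1"
  obtain v where v: "v \<in> V" "v \<noteq> 0"
    using nontriv subspace_0[OF V] by auto
  have "(1 / norm v) *\<^sub>R v \<in> S"
    using v by (simp add: S_def subspace_scale[OF V])
  then have "S \<noteq> {}" by blast
  have "compact S"
    unfolding S_def by (intro closed_Int_compact closed_subspace V) simp
  have contT: "continuous_on S T"
    using T by (simp add: linear_continuous_on linear_conv_bounded_linear)
  have "continuous_on S (\<lambda>x. B (T x) x / B x x)"
  proof (intro continuous_on_divide B.continuous_on contT continuous_on_id ballI)
    fix x assume "x \<in> S"
    then have "x \<noteq> 0" by (auto simp: S_def)
    then show "B x x \<noteq> 0" using pos[of x] by simp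
  qed
  from continuous_attains_sup[OF \<open>compact S\<close> \<open>S \<noteq> {}\<close> this]
  obtain x where xS: "x \<in> S" and max: "\<And>y. y \<in> S \<Longrightarrow> B (T y) y / B y y \<le> B (T x) x / B x x"
    by blast
  have x: "x \<in> V" "x \<noteq> 0" using xS by (auto simp: S_def)
  define \<mu> where "\<mu> = B (T x) x / B x x"
  define N where "N y = \<mu> *\<^sub>R y - T y" for y
  have linN: "linear N"
    unfolding N_def using T by (intro linear_compose_sub linear_compose_scale_right linear_ident)
  have N_in: "N y \<in> V" if "y \<in> V" for y
    using that inv by (auto simp: N_def intro!: subspace_diff subspace_scale V)
  have N_adj: "B (N y) z = B y (N z)" for y z
    by (simp add: N_def B.diff_left B.diff_right B.scaleR_left B.scaleR_right adj)
  \<comment> \<open>Maximality of \<open>\<mu>\<close> on the sphere extends to all of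
    \<open>V\<close> by normalising \<open>y\<close>; hence the form of \<open>N\<close> is
    nonnegative there, and it vanishes at the maximiser.\<close>
  have N_nonneg: "0 \<le> B (N y) y" if "y \<in> V" for y
  proof (cases "y = 0")
    case False
    have "(1 / norm y) *\<^sub>R y \<in> S"
      using that False by (simp add: S_def subspace_scale[OF V])
    from max[OF this] have "B (T y) y / B y y \<le> \<mu>"
      using False by (simp add: \<mu>_def linear_scale[OF T] B.scaleR_left B.scaleR_right)
    then show ?thesis
      using pos[OF False] by (simp add: N_def B.diff_left B.scaleR_left field_simps)
  qed (simp add: B.zero_right)
  have N_x: "B (N x) x = 0"
    using pos[OF x(2)] by (simp add: N_def \<mu>_def B.diff_left B.scaleR_left)
  text \<open>A nonnegative quadratic form that vanishes at \<open>x\<close> has \<open>x\<close> in its radical.\<close>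
  have "B (N x) (N x) = 0"
  proof (rule ccontr)
    define b where "b = B (N x) (N x)"
    define c where "c = B (N (N x)) (N x)"
    assume "B (N x) (N x) \<noteq> 0"
    then have b: "0 < b" using pos[of "N x"] by (cases "N x = 0") (simp_all add: b_def B.zero_left)
    have c: "0 \<le> c" unfolding c_def by (intro N_nonneg N_in x)
    \<comment> \<open>Along \<open>x - s *\<^sub>R N x\<close> the form of \<open>N\<close> equals
      \<open>s * (s * c - 2 * b)\<close>, negative for small positive \<open>s\<close>. The
      denominator \<open>c + 1\<close> makes \<open>s * c < b\<close> and stays positive when
      \<open>c = 0\<close>.\<close>
    define s where "s = b / (c + 1)"
    have s: "0 < s" "s * c < 2 * b"
      using b c by (auto simp: s_def field_simps intro: add_nonneg_pos)
    have "0 \<le> B (N (x - s *\<^sub>R N x)) (x - s *\<^sub>R N x)"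
      by (intro N_nonneg subspace_diff subspace_scale V x N_in)
    also have "\<dots> = s * (s * c - 2 * b)"
      using N_x N_adj[of "N x" x]
      by (simp add: linear_diff[OF linN] linear_scale[OF linN] B.diff_left B.diff_right
          B.scaleR_left B.scaleR_right b_def c_def algebra_simps)
    also have "\<dots> < 0" using s by (simp add: mult_pos_neg)
    finally show False by simp
  qed
  then have "N x = 0" using pos[of "N x"] by fastforce
  then have "T x = \<mu> *\<^sub>R x" by (simp add: N_def)
  with x that show ?thesis by blast
qed

lemma selfadjoint_eigenbasis:
  fixes T :: "'a::euclidean_space \<Rightarrow> 'a" and B :: "'a \<Rightarrow> 'a \<Rightarrow> real"
  assumes T: "linear T" and B: "bilinear B"
    and pos: "\<And>x. x \<noteq> 0 \<Longrightarrow> 0 < B x x"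
    and adj: "\<And>x y. B (T x) y = B x (T y)"
    and V: "subspace V" and inv: "T ` V \<subseteq> V"
  shows "\<exists>E. independent E \<and> span E = V \<and> (\<forall>e\<in>E. \<exists>\<mu>. T e = \<mu> *\<^sub>R e)"
  using V inv
proof (induction "dim V" arbitrary: V rule: less_induct)
  case less
  interpret B: bounded_bilinear B
    using B by (simp add: bilinear_conv_bounded_bilinear)
  show ?case
  proof (cases "V = {0}")
    case True
    then show ?thesis by (intro exI[of _ "{}"]) (simp add: independent_empty)
  next
    case False
    obtain x \<mu> where x: "x \<in> V" "x \<noteq> 0" "T x = \<mu> *\<^sub>R x"
      using selfadjoint_exists_eigenvector[OF T B pos adj less.prems False] by blast
    define W where "W = {y \<in> V. B x y = 0}"
    have W: "subspace W"
      using less.prems(1)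
      by (auto simp: W_def subspace_def B.add_right B.scaleR_right B.zero_right)
    have xW: "x \<notin> W" using pos[OF x(2)] by (simp add: W_def)
    have "W \<subset> V" using x xW by (auto simp: W_def)
    then have "dim W < dim V"
      using W less.prems(1) dim_psubset[of W V] by (simp add: span_eq_iff[THEN iffD2])
    moreover have "T ` W \<subseteq> W"
      using less.prems(2) by (auto simp: W_def adj[symmetric] x B.scaleR_left)
    ultimately obtain E where E: "independent E" "span E = W" "\<forall>e\<in>E. \<exists>\<mu>. T e = \<mu> *\<^sub>R e"
      using less.hyps W by meson
    have "independent (insert x E)"
      using E xW by (simp add: independent_insert)
    moreover have "span (insert x E) = V"
    proof
      show "span (insert x E) \<subseteq> V"
        using x E \<open>W \<subset> V\<close> less.prems(1) by (intro span_minimal) (auto intro: span_base)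
      show "V \<subseteq> span (insert x E)"
      proof
        fix y assume y: "y \<in> V"
        \<comment> \<open>Subtracting the \<open>B\<close>-projection onto \<open>x\<close> leaves a
          vector of \<open>W\<close>, which is the span of \<open>E\<close>.\<close>
        have "y - (B x y / B x x) *\<^sub>R x \<in> W"
          using y x pos[OF x(2)] less.prems(1)
          by (auto simp: W_def B.diff_right B.scaleR_right intro!: subspace_diff subspace_scale)
        then show "y \<in> span (insert x E)"
          using E by (auto simp: span_insert)
      qed
    qed
    ultimately show ?thesis using E x by blast
  qed
qed

text \<open>A free choice of \<open>B\<close> allows matrices that are not symmetric, such as the
  flux Jacobian. The eigenbasis supplies the columns of the diagonalizing matrix.\<close>

lemma real_diagonalizable_selfadjoint:
  fixes A :: "real ^ 'n ^ 'n" and B :: "real ^ 'n \<Rightarrow> real ^ 'n \<Rightarrow> real"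
  assumes B: "bilinear B"
    and pos: "\<And>x. x \<noteq> 0 \<Longrightarrow> 0 < B x x"
    and adj: "\<And>x y. B (A *v x) y = B x (A *v y)"
  shows "real_diagonalizable A"
proof -
  obtain E where E: "independent E" "span E = UNIV" "\<forall>e\<in>E. \<exists>\<mu>. A *v e = \<mu> *\<^sub>R e"
    using selfadjoint_eigenbasis[OF matrix_vector_mul_linear B pos adj subspace_UNIV subset_UNIV]
    by auto
  \<comment> \<open>The basis has as many vectors as \<open>'n\<close> has elements, so it can be
    indexed by \<open>'n\<close> and arranged as a square matrix.\<close>
  have "card E = CARD('n)"
    using dim_eq_card_independent[OF E(1)] dim_span[of E] E(2) by simp
  moreover have "finite E" using E by (simp add: independent_bound)
  ultimately obtain e where e: "bij_betw e (UNIV :: 'n set) E"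
    using finite_same_card_bij[of "UNIV :: 'n set" E] by auto
  then have "e i \<in> E" for i by (auto simp: bij_betw_def)
  with E(3) have "\<forall>i. \<exists>\<mu>. A *v e i = \<mu> *\<^sub>R e i" by simp
  then obtain \<mu> where \<mu>: "\<And>i. A *v e i = \<mu> i *\<^sub>R e i"
    unfolding choice_iff by auto
  define V :: "real ^ 'n ^ 'n" where "V = (\<chi> i j. e j $ i)"
  define D :: "real ^ 'n ^ 'n" where "D = (\<chi> i j. if i = j then \<mu> i else 0)"
  have col: "column j V = e j" for j by (simp add: column_def V_def vec_eq_iff)
  have "columns V = E"
    using bij_betw_imp_surj_on[OF e] by (simp add: columns_def col full_SetCompr_eq)
  then have V: "invertible V"
    using E(2) by (simp add: invertible_right_inverse matrix_right_invertible_span_columns span_vec_eq)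
  have "A ** V = V ** D"
  proof -
    have "(A ** V) $ i $ j = (V ** D) $ i $ j" for i j
    proof -
      have "(A ** V) $ i $ j = (A *v e j) $ i"
        by (simp add: matrix_matrix_mult_def matrix_vector_mult_def V_def)
      also have "\<dots> = (V ** D) $ i $ j"
        by (simp add: \<mu> matrix_matrix_mult_def V_def D_def
            if_distrib[of "\<lambda>c. _ * c"] cong: if_cong)
      finally show ?thesis .
    qed
    then show ?thesis by (simp add: vec_eq_iff)
  qed
  moreover have "V ** matrix_inv V = mat 1"
    using matrix_inv_cancel(2)[OF V] by (simp add: matrix_eq matrix_vector_mul_assoc)
  ultimately have "A = V ** D ** matrix_inv V"
    by (metis matrix_mul_assoc matrix_mul_rid)
  then show ?thesis
    unfolding real_diagonalizable_def
    by (intro exI[of _ V] exI[of _ D] conjI V allI impI) (simp_all add: D_def)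
qed

section \<open>Positive definite matrices and the block Jacobian\<close>

lemma symmetric_matrix_inner:
  fixes A :: "real ^ 'n ^ 'n"
  assumes "transpose A = A"
  shows "(A *v x) \<bullet> y = x \<bullet> (A *v y)"
  by (metis assms dot_lmul_matrix vector_transpose_matrix)

lemma posdef_invertible:
  fixes P :: "real ^ 'n ^ 'n"
  assumes "\<And>x. x \<noteq> 0 \<Longrightarrow> 0 < x \<bullet> (P *v x)"
  shows "invertible P"
proof -
  have "x = 0" if "P *v x = 0" for x
    using assms[of x] that by fastforce
  then show ?thesis
    using invertible_left_inverse matrix_left_invertible_ker by blast
qed

text \<open>
  In the coordinates \<open>(h, w)\<close> with \<open>w = q - A h\<close> the matrix becomes
  \<open>[[A, I], [g P, Q P\<^sup>-\<^sup>1]]\<close>, which is self-adjoint for the inner product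
  with matrix \<open>diag (g I, P\<^sup>-\<^sup>1)\<close>.
\<close>

lemma real_diagonalizable_block:
  fixes P A Q :: "real ^ 'k ^ 'k"
  assumes symP: "transpose P = P" and symA: "transpose A = A" and symQ: "transpose Q = Q"
    and pos: "\<And>x. x \<noteq> 0 \<Longrightarrow> 0 < x \<bullet> (P *v x)" and g: "0 < g"
  shows "real_diagonalizable (block_matrix 0 (mat 1)
           (g *\<^sub>R P - Q ** matrix_inv P ** A) (A + Q ** matrix_inv P))"
    (is "real_diagonalizable ?J")
proof -
  have inv: "invertible P" by (rule posdef_invertible[OF pos])
  define R where "R = matrix_inv P"
  have PR: "P *v (R *v x) = x" "R *v (P *v x) = x" for x
    using matrix_inv_cancel[OF inv] by (simp_all add: R_def)
  have adjP: "(P *v x) \<bullet> y = x \<bullet> (P *v y)" and adjA: "(A *v x) \<bullet> y = x \<bullet> (A *v y)"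
    and adjQ: "(Q *v x) \<bullet> y = x \<bullet> (Q *v y)" for x y
    by (simp_all add: symmetric_matrix_inner symP symA symQ)
  have adjR: "(R *v x) \<bullet> y = x \<bullet> (R *v y)" for x y
    using adjP[of "R *v x" "R *v y"] by (simp add: PR)
  have posR: "0 < x \<bullet> (R *v x)" if "x \<noteq> 0" for x
  proof -
    have "R *v x \<noteq> 0" using that PR(1)[of x] by auto
    from pos[OF this] show ?thesis by (simp add: PR inner_commute)
  qed
  define w where "w U = discharge U - A *v height U" for U :: "real ^ ('k + 'k)"
  define B where "B U V = g * (height U \<bullet> height V) + w U \<bullet> (R *v w V)"
    for U V :: "real ^ ('k + 'k)"
  have linw: "linear w"
    unfolding w_def
    by (intro linear_compose_sub linear_discharge
        linear_compose[OF linear_height matrix_vector_mul_linear, unfolded o_def])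
  have symB: "B x y = B y x" for x y
    using adjR[of "w x" "w y"] by (simp add: B_def inner_commute)
  have "linear (B U)" for U
    by (rule linearI)
      (simp_all add: B_def linear_add[OF linw] linear_scale[OF linw] linear_add[OF linear_height]
        linear_scale[OF linear_height] matrix_vector_right_distrib inner_add_right
        matrix_vector_mult_scaleR algebra_simps)
  then have bilB: "bilinear B"
    unfolding bilinear_def using symB by (metis (no_types, lifting) ext)
  have posB: "0 < B U U" if "U \<noteq> 0" for U
  proof (cases "height U = 0")
    case True
    then have "discharge U \<noteq> 0"
      using that by (auto simp: height_def discharge_def vec_eq_iff split_sum_all)
    then show ?thesis using True posR by (simp add: B_def w_def)
  next
    case False
    then show ?thesis
      using g posR[of "w U"] by (cases "w U = 0") (simp_all add: B_def add_pos_pos)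
  qed
  have heightJ: "height (?J *v U) = w U + A *v height U" for U
    by (simp add: block_matrix_mult w_def)
  \<comment> \<open>Since the height of the image is \<open>discharge U\<close>, subtracting
    \<open>A\<close> times it cancels the summand \<open>A\<close> of the lower right block. The two
    terms containing \<open>Q\<close> combine to \<open>Q *v (R *v w U)\<close>.\<close>
  have wJ: "w (?J *v U) = g *\<^sub>R (P *v height U) + Q *v (R *v w U)" for U
    by (simp add: block_matrix_mult w_def R_def matrix_vector_mult_diff_rdistrib
        matrix_vector_mult_add_rdistrib matrix_vector_mult_diff_distrib
        matrix_vector_mul_assoc scaleR_matrix_vector_assoc matrix_mul_assoc)
  have "B (?J *v U) V = B U (?J *v V)" for U V
  proof -
    \<comment> \<open>In the cross terms \<open>P\<close> and \<open>R\<close> cancel, leaving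
      \<open>g\<close> times plain dot products of a height with a \<open>w\<close>. The weight
      \<open>g\<close> on the heights in \<open>B\<close> makes the two cross terms exchange roles
      when \<open>U\<close> and \<open>V\<close> are swapped.\<close>
    have "(P *v height U) \<bullet> (R *v w V) = height U \<bullet> w V"
      "w U \<bullet> (R *v (P *v height V)) = w U \<bullet> height V"
      "(Q *v (R *v w U)) \<bullet> (R *v w V) = w U \<bullet> (R *v (Q *v (R *v w V)))"
      by (simp_all only: adjP adjQ adjR PR)
    then show ?thesis
      by (simp add: B_def heightJ wJ inner_add_left inner_add_right matrix_vector_right_distrib
          matrix_vector_mult_scaleR adjA ring_distribs)
  qed
  from real_diagonalizable_selfadjoint[OF bilB posB this] show ?thesis .
qed

section \<open>Galerkin matrices and quadrature\<close>

lemma transpose_galerkin_matrix: "transpose (galerkin_matrix \<rho> \<phi> y) = galerkin_matrix \<rho> \<phi> y"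
  by (simp add: transpose_def galerkin_matrix_nth vec_eq_iff triple_matrix_def mult.commute)

lemma poly_space_power_three:
  assumes "a \<in> poly_space \<Lambda>" "b \<in> poly_space \<Lambda>" "c \<in> poly_space \<Lambda>"
  shows "(\<lambda>s. a s * b s * c s) \<in> poly_space_power \<Lambda> 3"
proof -
  define p where "p j = (if j = 1 then a else if j = 2 then b else c)" for j :: nat
  have "(\<lambda>s. a s * b s * c s) = (\<lambda>s. \<Prod>j = 1..3. p j s)"
    by (simp add: p_def numeral_3_eq_3 fun_eq_iff)
  moreover have "\<forall>j\<in>{1..3}. p j \<in> poly_space \<Lambda>"
    using assms by (simp add: p_def)
  ultimately show ?thesis
    unfolding poly_space_power_def by (intro fun_space.span_base) blast
qed

context
  fixes \<rho> :: "real ^ 'd \<Rightarrow> real" and \<Lambda> :: "(nat ^ 'd) set"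
    and \<phi> :: "'k::finite \<Rightarrow> real ^ 'd \<Rightarrow> real"
    and M :: nat and \<xi> :: "nat \<Rightarrow> real ^ 'd" and \<tau> :: "nat \<Rightarrow> real"
  assumes basis: "orthonormal_basis \<rho> (poly_space \<Lambda>) \<phi>"
    and quad: "positive_quadrature \<rho> (poly_space_power \<Lambda> 3) M \<xi> \<tau>"
begin

lemma triple_product_quadrature:
  "inner_rho \<rho> (\<phi> k) (\<lambda>s. \<phi> l s * \<phi> m s)
    = (\<Sum>i = 1..M. \<phi> k (\<xi> i) * \<phi> l (\<xi> i) * \<phi> m (\<xi> i) * \<tau> i)"
proof -
  have mem: "\<phi> j \<in> poly_space \<Lambda>" for j
    using basis fun_space.span_base[of "\<phi> j" "range \<phi>"] by (simp add: orthonormal_basis_def)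
  have "(\<lambda>s. \<phi> k s * \<phi> l s * \<phi> m s) \<in> poly_space_power \<Lambda> 3"
    by (rule poly_space_power_three[OF mem mem mem])
  from bspec[OF conjunct2[OF quad[unfolded positive_quadrature_def]] this]
  show ?thesis by (simp add: inner_rho_def mult.assoc)
qed

text \<open>Every entry of the triple-product matrices is a quadrature sum. Once the node index is
  outermost, the sum over the three basis indices factors at each node.\<close>

lemma galerkin_form_quadrature:
  "a \<bullet> (galerkin_matrix \<rho> \<phi> y *v a)
    = (\<Sum>i = 1..M. (\<Sum>k\<in>UNIV. y $ k * \<phi> k (\<xi> i)) * (\<Sum>k\<in>UNIV. a $ k * \<phi> k (\<xi> i))\<^sup>2 * \<tau> i)"
proof -
  have "a \<bullet> (galerkin_matrix \<rho> \<phi> y *v a)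
      = (\<Sum>l\<in>UNIV. \<Sum>m\<in>UNIV. \<Sum>k\<in>UNIV. \<Sum>i = 1..M.
          a $ l * (y $ k * (\<phi> k (\<xi> i) * \<phi> l (\<xi> i) * \<phi> m (\<xi> i) * \<tau> i) * a $ m))"
    by (simp add: inner_vec_def matrix_vector_mult_def galerkin_matrix_nth triple_matrix_def
        triple_product_quadrature sum_distrib_left sum_distrib_right)
  also have "\<dots> = (\<Sum>l\<in>UNIV. \<Sum>m\<in>UNIV. \<Sum>i = 1..M. \<Sum>k\<in>UNIV.
          a $ l * (y $ k * (\<phi> k (\<xi> i) * \<phi> l (\<xi> i) * \<phi> m (\<xi> i) * \<tau> i) * a $ m))"
    by (intro sum.cong refl sum.swap)
  also have "\<dots> = (\<Sum>l\<in>UNIV. \<Sum>i = 1..M. \<Sum>m\<in>UNIV. \<Sum>k\<in>UNIV.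
          a $ l * (y $ k * (\<phi> k (\<xi> i) * \<phi> l (\<xi> i) * \<phi> m (\<xi> i) * \<tau> i) * a $ m))"
    by (intro sum.cong refl sum.swap)
  also have "\<dots> = (\<Sum>i = 1..M. \<Sum>l\<in>UNIV. \<Sum>m\<in>UNIV. \<Sum>k\<in>UNIV.
          a $ l * (y $ k * (\<phi> k (\<xi> i) * \<phi> l (\<xi> i) * \<phi> m (\<xi> i) * \<tau> i) * a $ m))"
    by (rule sum.swap)
  also have "\<dots> = (\<Sum>i = 1..M. (\<Sum>k\<in>UNIV. y $ k * \<phi> k (\<xi> i))
      * (\<Sum>k\<in>UNIV. a $ k * \<phi> k (\<xi> i))\<^sup>2 * \<tau> i)"
  proof (rule sum.cong[OF refl])
    fix i
    have "(\<Sum>k\<in>UNIV. y $ k * \<phi> k (\<xi> i)) * (\<Sum>k\<in>UNIV. a $ k * \<phi> k (\<xi> i))\<^sup>2 * \<tau> i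
      = (\<Sum>l\<in>UNIV. a $ l * \<phi> l (\<xi> i) * (\<Sum>m\<in>UNIV. a $ m * \<phi> m (\<xi> i) *
            (\<Sum>k\<in>UNIV. y $ k * \<phi> k (\<xi> i) * \<tau> i)))"
      unfolding sum_distrib_right[symmetric] by (simp add: power2_eq_square)
    also have "\<dots> = (\<Sum>l\<in>UNIV. \<Sum>m\<in>UNIV. \<Sum>k\<in>UNIV.
          a $ l * (y $ k * (\<phi> k (\<xi> i) * \<phi> l (\<xi> i) * \<phi> m (\<xi> i) * \<tau> i) * a $ m))"
      by (simp add: sum_distrib_left mult_ac)
    finally show "(\<Sum>l\<in>UNIV. \<Sum>m\<in>UNIV. \<Sum>k\<in>UNIV.
          a $ l * (y $ k * (\<phi> k (\<xi> i) * \<phi> l (\<xi> i) * \<phi> m (\<xi> i) * \<tau> i) * a $ m))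
      = (\<Sum>k\<in>UNIV. y $ k * \<phi> k (\<xi> i)) * (\<Sum>k\<in>UNIV. a $ k * \<phi> k (\<xi> i))\<^sup>2 * \<tau> i" ..
  qed
  finally show ?thesis .
qed

text \<open>The vector \<open>axis k\<^sub>1 1\<close> represents the constant function 1, so its
  Galerkin matrix is the Gram matrix of the basis. This turns \<open>a \<bullet> a\<close> into a
  Galerkin form, to which exactness on triple products applies.\<close>

lemma galerkin_matrix_axis_one:
  assumes "\<phi> k\<^sub>1 = (\<lambda>_. 1)"
  shows "galerkin_matrix \<rho> \<phi> (axis k\<^sub>1 1) = mat 1"
proof -
  have "inner_rho \<rho> (\<phi> k\<^sub>1) (\<lambda>s. \<phi> l s * \<phi> m s) = inner_rho \<rho> (\<phi> l) (\<phi> m)" for l m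
    by (simp add: assms inner_rho_def)
  then show ?thesis
    using basis
    by (simp add: vec_eq_iff galerkin_matrix_nth triple_matrix_def axis_def mat_def
        orthonormal_basis_def if_distrib[of "\<lambda>c. c * _"] cong: if_cong)
qed

lemma galerkin_matrix_posdef:
  assumes one: "\<phi> k\<^sub>1 = (\<lambda>_. 1)"
    and pos: "\<forall>m\<in>{1..M}. 0 < (\<Sum>k\<in>UNIV. y $ k * \<phi> k (\<xi> m))"
    and a: "a \<noteq> 0"
  shows "0 < a \<bullet> (galerkin_matrix \<rho> \<phi> y *v a)"
proof -
  define v where "v i = (\<Sum>k\<in>UNIV. a $ k * \<phi> k (\<xi> i))" for i
  have \<tau>: "0 < \<tau> i" if "i \<in> {1..M}" for i
    using quad that by (simp add: positive_quadrature_def)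
  have "a \<bullet> a = a \<bullet> (galerkin_matrix \<rho> \<phi> (axis k\<^sub>1 1) *v a)"
    by (simp add: galerkin_matrix_axis_one[OF one])
  also have "\<dots> = (\<Sum>i = 1..M. (v i)\<^sup>2 * \<tau> i)"
    by (simp add: galerkin_form_quadrature v_def axis_def one if_distrib[of "\<lambda>c. c * _"] cong: if_cong)
  finally have "(\<Sum>i = 1..M. (v i)\<^sup>2 * \<tau> i) = a \<bullet> a" ..
  with a have "(\<Sum>i = 1..M. (v i)\<^sup>2 * \<tau> i) \<noteq> 0"
    by (simp only: inner_eq_zero_iff not_False_eq_True)
  \<comment> \<open>A nonzero coefficient vector cannot give a function vanishing at every node.
    This node contributes strictly to the form, and all others contribute nonnegatively.\<close>
  then obtain i where i: "i \<in> {1..M}" "v i \<noteq> 0"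
    by (elim sum.not_neutral_contains_not_neutral) simp
  have "0 < (\<Sum>i = 1..M. (\<Sum>k\<in>UNIV. y $ k * \<phi> k (\<xi> i)) * (v i)\<^sup>2 * \<tau> i)"
  proof (rule sum_pos2[OF _ i(1)])
    show "0 < (\<Sum>k\<in>UNIV. y $ k * \<phi> k (\<xi> i)) * (v i)\<^sup>2 * \<tau> i"
      using i pos \<tau> by simp
    show "0 \<le> (\<Sum>k\<in>UNIV. y $ k * \<phi> k (\<xi> j)) * (v j)\<^sup>2 * \<tau> j" if "j \<in> {1..M}" for j
      using that pos \<tau>[OF that] by (simp add: less_imp_le)
  qed simp
  then show ?thesis by (simp add: galerkin_form_quadrature v_def)
qed

end

theorem theorem3p2:
  fixes \<rho> :: "real ^ 'd \<Rightarrow> real"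
    and \<Lambda> :: "(nat ^ 'd) set"
    and \<phi> :: "'k::finite \<Rightarrow> real ^ 'd \<Rightarrow> real"
    and k\<^sub>1 :: 'k
    and g :: real
    and M :: nat
    and \<xi> :: "nat \<Rightarrow> real ^ 'd"
    and \<tau> :: "nat \<Rightarrow> real"
    and h q :: "real \<Rightarrow> real \<Rightarrow> real ^ 'k"
    and x t :: real
  assumes "probability_density \<rho>"
    and "finite_moments \<rho>"
    and "finite \<Lambda>" and "0 \<in> \<Lambda>" and "card \<Lambda> = CARD('k)"
    and "orthonormal_basis \<rho> (poly_space \<Lambda>) \<phi>"
    and "\<phi> k\<^sub>1 = (\<lambda>_. 1)"
    and "0 < g"
    and "positive_quadrature \<rho> (poly_space_power \<Lambda> 3) M \<xi> \<tau>"
    and "\<forall>m\<in>{1..M}. 0 < (\<Sum>k\<in>UNIV. h x t $ k * \<phi> k (\<xi> m))"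
  shows "sgswe_hyperbolic_at g \<rho> \<phi> (stack (h x t) (q x t))"
proof -
  define P where "P = galerkin_matrix \<rho> \<phi>"
  have pos: "0 < a \<bullet> (P (h x t) *v a)" if "a \<noteq> 0" for a
    unfolding P_def by (rule galerkin_matrix_posdef[OF assms(6,9,7,10) that])
  then have inv: "invertible (P (h x t))" by (rule posdef_invertible)
  have sym: "transpose (P y) = P y" for y
    unfolding P_def by (rule transpose_galerkin_matrix)
  have "jacobian (sgswe_flux g \<rho> \<phi>) (at (stack (h x t) (q x t)))
      = sgswe_jacobian g \<rho> \<phi> (stack (h x t) (q x t))"
    using inv by (intro jacobian_sgswe_flux) (simp add: P_def)
  \<comment> \<open>Here \<open>A\<close> is the Galerkin matrix of the velocity and
    \<open>Q\<close> that of the discharge. Both are symmetric for any discharge; positivity is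
    required of the height matrix alone.\<close>
  moreover have "real_diagonalizable (sgswe_jacobian g \<rho> \<phi> (stack (h x t) (q x t)))"
    unfolding sgswe_jacobian_def Let_def height_stack discharge_stack P_def[symmetric]
    by (rule real_diagonalizable_block[OF sym sym sym pos assms(8)])
  ultimately show ?thesis
    using inv by (simp add: sgswe_hyperbolic_at_def P_def)
qed

end
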